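(* For a pattern $\tau$ let $B_\tau(x)=\sum_{n\ge0}|\mathfrak D^1_{2n}(2341,2413,\tau)|\,x^n$. Let $\ell\ge2$ and let $\tau=\ell\tau'\in\mathfrak S_\ell$ be a pattern with $\tau_\ell\ne\ell-1$. Then \[ B_\tau(x)=\frac{1}{1+x-2xB_{\tau'}(x)}. \]
   Context: A permutation $\sigma\in\mathfrak S_N$ contains a pattern $\tau\in\mathfrak S_k$ if there are positions $i_1<\dots<i_k$ such that $(\sigma(i_1),\dots,\sigma(i_k))$ is order-isomorphic to $\tau$; otherwise $\sigma$ avoids $\tau$. A Dumont permutation of the first kind is a permutation $\pi\in\mathfrak S_{2n}$ such that for every $i=1,\dots,2n$: if $\pi(i)$ is even then $i<2n$ and $\pi(i)>\pi(i+1)$; if $\pi(i)$ is odd then $i=2n$ or $\pi(i)<\pi(i+1)$. $\mathfrak D^1_{2n}(T)$ denotes the set of Dumont permutations of the first kind of length $2n$ avoiding all listed patterns $T$ (for $n=0$ the only Dumont permutation is the empty one). $\ell\tau'$ denotes the letter $\ell$ followed by the word $\tau'\in\mathfrak S_{\ell-1}$ in one-line notation; $\tau_\ell$ is the last letter of $\tau$. Identities are of formal power series in $x$. *)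

theory Defs
  imports "HOL-Combinatorics.Multiset_Permutations"
    "HOL-Computational_Algebra.Formal_Power_Series"
begin

text \<open>
  Permutations are words in one-line notation, i.e. lists over the letters 1, ..., N.
  Letters are thus 1-based, while list positions are 0-based: \<open>\<pi> ! i\<close> is $\pi(i+1)$.
\<close>

definition perms :: "nat \<Rightarrow> nat list set" where
  "perms N = permutations_of_set {1..N}"

definition contains_pattern :: "nat list \<Rightarrow> nat list \<Rightarrow> bool" where
  "contains_pattern \<sigma> \<tau> \<longleftrightarrow>
     (\<exists>p :: nat \<Rightarrow> nat.
        strict_mono_on {..<length \<tau>} p \<and>
        (\<forall>a<length \<tau>. p a < length \<sigma>) \<and>
        (\<forall>a<length \<tau>. \<forall>b<length \<tau>. \<sigma> ! p a < \<sigma> ! p b \<longleftrightarrow> \<tau> ! a < \<tau> ! b))"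

definition avoids :: "nat list \<Rightarrow> nat list \<Rightarrow> bool" where
  "avoids \<sigma> \<tau> \<longleftrightarrow> \<not> contains_pattern \<sigma> \<tau>"

definition dumont1 :: "nat \<Rightarrow> nat list set" where
  "dumont1 n = {\<pi> \<in> perms (2 * n). \<forall>i<2 * n.
     (even (\<pi> ! i) \<longrightarrow> Suc i < 2 * n \<and> \<pi> ! i > \<pi> ! Suc i) \<and>
     (odd (\<pi> ! i) \<longrightarrow> Suc i = 2 * n \<or> \<pi> ! i < \<pi> ! Suc i)}"

definition dumont1_avoiding :: "nat \<Rightarrow> nat list set \<Rightarrow> nat list set" where
  "dumont1_avoiding n T = {\<pi> \<in> dumont1 n. \<forall>\<tau>\<in>T. avoids \<pi> \<tau>}"

definition B :: "nat list \<Rightarrow> rat fps" where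
  "B \<tau> = Abs_fps (\<lambda>n. of_nat (card (dumont1_avoiding n {[2,3,4,1], [2,4,1,3], \<tau>})))"

end

theory Submission
  imports Defs "HOL-Library.Sublist"
begin

text \<open>
  A nonempty Dumont permutation of length $2n$ either ends in $2n-1$ or has $2n-1$
  immediately followed by $2n$, as odd letters are followed by ascents. In the first case
  avoidance of 2413, in the second avoidance of 2341, forces every letter before the first
  of the two top letters to be smaller than every letter after it. Hence the permutation is
  $\alpha \oplus (2k\,\sigma\,(2k-1))$, or $\alpha \oplus ((2k-1)\,2k\,\sigma)$ with
  $\sigma$ nonempty, where $\alpha$ and $\sigma$ are Dumont permutations of even length
  (the length of $\alpha$ is even since the smallest letter of a Dumont word is odd).
  Such a sum avoids $\tau = \ell\tau'$ iff $\alpha$ avoids $\tau$ and $\sigma$ avoids $\tau'$: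
  the pattern starts with its maximum, so it cannot spread over a direct sum, and a top
  letter following $\sigma$ is useless because $\tau'$ does not end in its maximum.
  Counting gives $B_\tau = 1 + x B_\tau (2 B_{\tau'} - 1)$.
\<close>

section \<open>Words over arbitrary letters that satisfy the Dumont condition\<close>

fun dumont_word :: "nat list \<Rightarrow> bool" where
  "dumont_word [] \<longleftrightarrow> True"
| "dumont_word [x] \<longleftrightarrow> odd x"
| "dumont_word (x # y # zs) \<longleftrightarrow> (if even x then y < x else x < y) \<and> dumont_word (y # zs)"

lemma dumont_word_iff_nth:
  "dumont_word xs \<longleftrightarrow> (\<forall>i<length xs.
     (even (xs ! i) \<longrightarrow> Suc i < length xs \<and> xs ! i > xs ! Suc i) \<and>
     (odd (xs ! i) \<longrightarrow> Suc i = length xs \<or> xs ! i < xs ! Suc i))"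
proof (induction xs rule: dumont_word.induct)
  case (3 x y zs)
  show ?case
    unfolding dumont_word.simps 3 by (subst (3) length_Cons) (auto simp: All_less_Suc2)
qed auto

text \<open>The junction is an ascent, so it asks the last letter of \<open>xs\<close> to be odd;
  \<open>dumont_word xs\<close> asks the same of its final letter.\<close>

lemma dumont_word_append:
  assumes "\<And>x y. x \<in> set xs \<Longrightarrow> y \<in> set ys \<Longrightarrow> x < y"
  shows "dumont_word (xs @ ys) \<longleftrightarrow> dumont_word xs \<and> dumont_word ys"
  using assms
proof (induction xs rule: dumont_word.induct)
  case (2 x)
  then show ?case by (cases ys) (auto dest: less_asym)
qed auto

lemma dumont_word_map_add_even:
  "even m \<Longrightarrow> dumont_word (map ((+) m) xs) \<longleftrightarrow> dumont_word xs"
  by (induction xs rule: dumont_word.induct) auto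

lemma dumont_word_even_descent:
  assumes "dumont_word (xs @ x # ys)" "even x"
  shows "ys \<noteq> []" "hd ys < x"
  using assms by (induction xs rule: dumont_word.induct; cases ys; auto)+

lemma dumont_word_odd_ascent:
  assumes "dumont_word (xs @ x # ys)" "odd x" "ys \<noteq> []"
  shows "x < hd ys"
  using assms by (induction xs rule: dumont_word.induct; cases ys; auto)+

text \<open>The descent after \<open>x\<close> is automatic. Nonemptiness of \<open>xs\<close>
  matters, because an even letter must not be the last one.\<close>

lemma dumont_word_Cons_even:
  assumes "even x" "xs \<noteq> []" "\<And>y. y \<in> set xs \<Longrightarrow> y < x"
  shows "dumont_word (x # xs) \<longleftrightarrow> dumont_word xs"
  using assms by (cases xs) auto

lemma dumont1_iff: "\<pi> \<in> dumont1 n \<longleftrightarrow> \<pi> \<in> perms (2 * n) \<and> dumont_word \<pi>"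
proof -
  have "length \<pi> = 2 * n" if "\<pi> \<in> perms (2 * n)"
    using that length_finite_permutations_of_set[of \<pi> "{1..2 * n}"] by (simp add: perms_def)
  then show ?thesis by (auto simp: dumont1_def dumont_word_iff_nth)
qed

section \<open>Permutations, and pattern occurrences as subsequences\<close>

lemma perms_iff: "\<pi> \<in> perms n \<longleftrightarrow> set \<pi> = {1..n} \<and> distinct \<pi>"
  by (simp add: perms_def permutations_of_set_def)

lemma length_perms: "\<pi> \<in> perms n \<Longrightarrow> length \<pi> = n"
  using length_finite_permutations_of_set[of \<pi> "{1..n}"] by (simp add: perms_def)

lemma finite_perms: "finite (perms n)"
  by (simp add: perms_def)

lemma subseq_set: "subseq xs ys \<Longrightarrow> set xs \<subseteq> set ys"
  by (auto simp: subseq_conv_nths dest: in_set_nthsD)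

definition order_iso :: "nat list \<Rightarrow> nat list \<Rightarrow> bool" where
  "order_iso xs \<tau> \<longleftrightarrow> length xs = length \<tau> \<and>
     (\<forall>a<length \<tau>. \<forall>b<length \<tau>. xs ! a < xs ! b \<longleftrightarrow> \<tau> ! a < \<tau> ! b)"

lemma order_iso_length: "order_iso xs \<tau> \<Longrightarrow> length xs = length \<tau>"
  by (simp add: order_iso_def)

lemma order_iso_less_iff:
  "order_iso xs \<tau> \<Longrightarrow> a < length \<tau> \<Longrightarrow> b < length \<tau> \<Longrightarrow> xs ! a < xs ! b \<longleftrightarrow> \<tau> ! a < \<tau> ! b"
  by (simp add: order_iso_def)

text \<open>Bridges the position maps in \<open>contains_pattern\<close> and subsequences, whose
  rules for \<open>@\<close> and \<open>#\<close> drive the later case analyses.\<close>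

lemma subseq_nth_iff:
  "subseq xs ys \<longleftrightarrow> (\<exists>p. strict_mono_on {..<length xs} p \<and>
     (\<forall>a<length xs. p a < length ys \<and> xs ! a = ys ! p a))"
proof
  assume "subseq xs ys"
  then obtain N where "xs = nths ys N" by (auto simp: subseq_conv_nths)
  also have "\<dots> = map ((!) ys) (nths [0..<length ys] N)"
    by (metis map_nth nths_map)
  finally have xs: "xs = map ((!) ys) (nths [0..<length ys] N)" .
  \<comment> \<open>The increasing list of selected positions; its \<open>nth\<close> function
    serves as \<open>p\<close>.\<close>
  let ?is = "nths [0..<length ys] N"
  have sorted: "sorted_wrt (<) ?is"
    by (simp add: strict_sorted_iff sorted_nths distinct_nthsI)
  have "set ?is \<subseteq> {0..<length ys}"
    using set_nths_subset[of "[0..<length ys]" N] by auto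
  then have "?is ! a < length ys" if "a < length ?is" for a
    using that nth_mem by fastforce
  with sorted show "\<exists>p. strict_mono_on {..<length xs} p \<and>
     (\<forall>a<length xs. p a < length ys \<and> xs ! a = ys ! p a)"
    by (intro exI[of _ "(!) ?is"]) (auto simp: xs strict_mono_on_def sorted_wrt_iff_nth_less)
next
  assume "\<exists>p. strict_mono_on {..<length xs} p \<and>
     (\<forall>a<length xs. p a < length ys \<and> xs ! a = ys ! p a)"
  then obtain p where p: "strict_mono_on {..<length xs} p"
    "\<And>a. a < length xs \<Longrightarrow> p a < length ys \<and> xs ! a = ys ! p a" by auto
  let ?is = "map p [0..<length xs]"
  \<comment> \<open>Two strictly sorted lists with the same set coincide, so the positions chosen by
    \<open>p\<close> are a filtered, hence subsequence, part of all positions.\<close>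
  have "sorted_wrt (<) ?is"
    using p(1) by (auto simp: sorted_wrt_iff_nth_less strict_mono_on_def)
  moreover have "sorted_wrt (<) (filter (\<lambda>i. i \<in> set ?is) [0..<length ys])"
    by (rule sorted_wrt_filter) simp
  moreover have "set (filter (\<lambda>i. i \<in> set ?is) [0..<length ys]) = set ?is"
    using p(2) by auto
  ultimately have "filter (\<lambda>i. i \<in> set ?is) [0..<length ys] = ?is"
    by (metis strict_sorted_equal)
  then have "subseq ?is [0..<length ys]"
    by (metis subseq_filter_left)
  then have "subseq (map ((!) ys) ?is) (map ((!) ys) [0..<length ys])"
    by (rule subseq_map)
  moreover have "map ((!) ys) ?is = xs"
    using p(2) by (auto intro: nth_equalityI)
  ultimately show "subseq xs ys" by (simp add: map_nth)
qed

lemma contains_pattern_iff_subseq: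
  "contains_pattern \<sigma> \<tau> \<longleftrightarrow> (\<exists>xs. subseq xs \<sigma> \<and> order_iso xs \<tau>)"
proof
  assume "contains_pattern \<sigma> \<tau>"
  then obtain p where p: "strict_mono_on {..<length \<tau>} p" "\<forall>a<length \<tau>. p a < length \<sigma>"
    "\<forall>a<length \<tau>. \<forall>b<length \<tau>. \<sigma> ! p a < \<sigma> ! p b \<longleftrightarrow> \<tau> ! a < \<tau> ! b"
    unfolding contains_pattern_def by blast
  let ?xs = "map (\<lambda>a. \<sigma> ! p a) [0..<length \<tau>]"
  have "subseq ?xs \<sigma>" using p(1,2) by (auto simp: subseq_nth_iff)
  moreover have "order_iso ?xs \<tau>" using p(3) by (simp add: order_iso_def)
  ultimately show "\<exists>xs. subseq xs \<sigma> \<and> order_iso xs \<tau>" by blast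
next
  assume "\<exists>xs. subseq xs \<sigma> \<and> order_iso xs \<tau>"
  then obtain xs p where "order_iso xs \<tau>" "strict_mono_on {..<length xs} p"
    "\<forall>a<length xs. p a < length \<sigma> \<and> xs ! a = \<sigma> ! p a"
    by (auto simp: subseq_nth_iff)
  then show "contains_pattern \<sigma> \<tau>"
    unfolding contains_pattern_def order_iso_def by (intro exI[of _ p]) auto
qed

lemma contains_patternE:
  assumes "contains_pattern \<sigma> \<tau>"
  obtains us where "subseq us \<sigma>" "order_iso us \<tau>"
  using assms contains_pattern_iff_subseq by auto

section \<open>Pattern containment under shifts, direct sums and added top letters\<close>

lemma contains_pattern_map_add: "contains_pattern (map ((+) m) \<sigma>) \<tau> \<longleftrightarrow> contains_pattern \<sigma> \<tau>"
  unfolding contains_pattern_def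
  by (intro ex_cong1 conj_cong) auto

lemma contains_pattern_subseq:
  "contains_pattern xs \<tau> \<Longrightarrow> subseq xs ys \<Longrightarrow> contains_pattern ys \<tau>"
  using subseq_order.order_trans by (auto simp: contains_pattern_iff_subseq)

text \<open>Here \<open>i\<close> is a cut between positions \<open>i - 1\<close> and
  \<open>i\<close>, and \<open>a\<close>, \<open>b\<close> form a pair across it that is not
  ascending. For a permutation this excludes a direct sum of two nonempty parts.\<close>

definition sum_indecomposable :: "nat list \<Rightarrow> bool" where
  "sum_indecomposable \<tau> \<longleftrightarrow>
     (\<forall>i. 0 < i \<longrightarrow> i < length \<tau> \<longrightarrow> (\<exists>a b. a < i \<and> i \<le> b \<and> b < length \<tau> \<and> \<not> \<tau> ! a < \<tau> ! b))"

text \<open>An occurrence splits as \<open>vs @ ws\<close>. If both parts were nonempty, all pairs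
  across the cut \<open>length vs\<close> would ascend, against indecomposability.\<close>

lemma contains_pattern_append:
  assumes "\<And>x y. x \<in> set xs \<Longrightarrow> y \<in> set ys \<Longrightarrow> x < y" and "sum_indecomposable \<tau>"
  shows "contains_pattern (xs @ ys) \<tau> \<longleftrightarrow> contains_pattern xs \<tau> \<or> contains_pattern ys \<tau>"
proof
  assume "contains_pattern (xs @ ys) \<tau>"
  then obtain us where "subseq us (xs @ ys)" and iso: "order_iso us \<tau>"
    by (auto simp: contains_pattern_iff_subseq)
  then obtain vs ws where us: "us = vs @ ws" and sub: "subseq vs xs" "subseq ws ys"
    by (auto simp: subseq_append_iff)
  have "vs = [] \<or> ws = []"
  proof (rule ccontr)
    assume "\<not> ?thesis"
    then have "0 < length vs" "0 < length ws" by auto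
    moreover have "length vs + length ws = length \<tau>"
      using iso us by (simp add: order_iso_def)
    ultimately have "0 < length vs" "length vs < length \<tau>" by linarith+
    then obtain a b where ab: "a < length vs" "length vs \<le> b" "b < length \<tau>" "\<not> \<tau> ! a < \<tau> ! b"
      using assms(2) unfolding sum_indecomposable_def by blast
    then have "\<not> us ! a < us ! b" using iso by (auto simp: order_iso_def)
    moreover have "us ! a \<in> set vs" using ab by (simp add: us nth_append)
    moreover have "us ! b \<in> set ws" using ab iso by (auto simp: us nth_append order_iso_def)
    ultimately show False
      using assms(1) sub[THEN subseq_set] by blast
  qed
  then show "contains_pattern xs \<tau> \<or> contains_pattern ys \<tau>"
    using us sub iso by (auto simp: contains_pattern_iff_subseq)
next
  assume "contains_pattern xs \<tau> \<or> contains_pattern ys \<tau>"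
  then show "contains_pattern (xs @ ys) \<tau>"
    by (auto intro: contains_pattern_subseq)
qed


text \<open>Standing in front, \<open>x\<close> could only play the first letter of
  \<open>\<tau>\<close>; the larger letter at \<open>b\<close> would then need a value above the
  maximum \<open>x\<close>.\<close>

lemma contains_pattern_Cons_max_drop:
  assumes "\<And>y. y \<in> set xs \<Longrightarrow> y < x" "b < length \<tau>" "\<tau> ! 0 < \<tau> ! b"
  shows "contains_pattern (x # xs) \<tau> \<longleftrightarrow> contains_pattern xs \<tau>"
proof
  assume "contains_pattern (x # xs) \<tau>"
  then obtain us where us: "subseq us (x # xs)" and iso: "order_iso us \<tau>"
    by (auto simp: contains_pattern_iff_subseq)
  have "us ! 0 < us ! b" "b < length us"
    using order_iso_less_iff[OF iso _ assms(2), of 0] order_iso_length[OF iso] assms(2,3)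
    by (cases \<tau>; simp)+
  moreover from this have "us ! b \<in> insert x (set xs)"
    using subseq_set[OF us] nth_mem[of b us] unfolding list.set by blast
  then have "us ! b \<le> x"
    using assms(1) by (auto intro: less_imp_le)
  ultimately have "us ! 0 \<noteq> x" by simp
  then have "subseq us xs" using us \<open>b < length us\<close> by (cases us) auto
  then show "contains_pattern xs \<tau>" using iso by (auto simp: contains_pattern_iff_subseq)
qed (auto intro: contains_pattern_subseq)

text \<open>Mirror image of the previous argument: \<open>x\<close> could only play the last letter
  of \<open>\<tau>\<close>, and the letter at \<open>b\<close> would have to exceed it.\<close>

lemma contains_pattern_snoc_max_drop:
  assumes "\<And>y. y \<in> set xs \<Longrightarrow> y < x" "b < length \<tau>" "last \<tau> < \<tau> ! b"
  shows "contains_pattern (xs @ [x]) \<tau> \<longleftrightarrow> contains_pattern xs \<tau>"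
proof
  assume "contains_pattern (xs @ [x]) \<tau>"
  then obtain us where us: "subseq us (xs @ [x])" and iso: "order_iso us \<tau>"
    by (auto simp: contains_pattern_iff_subseq)
  have len: "b < length us" using iso assms(2) by (auto simp: order_iso_def)
  then have ne: "us \<noteq> []" "\<tau> \<noteq> []" using assms(2) by auto
  then have "last us < us ! b"
    using order_iso_less_iff[OF iso _ assms(2), of "length \<tau> - 1"] order_iso_length[OF iso] assms(3)
    by (simp add: last_conv_nth)
  moreover have "us ! b \<in> insert x (set xs)"
    using subseq_set[OF us] nth_mem[OF len] by auto
  then have "us ! b \<le> x"
    using assms(1) by (auto intro: less_imp_le)
  ultimately have "last us \<noteq> x" by simp
  obtain vs ws where vs: "us = vs @ ws" "subseq vs xs" "subseq ws [x]"
    using us unfolding subseq_append_iff by blast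
  then have "ws = [] \<or> ws = [x]"
    by (cases ws) (auto split: if_splits)
  then have "subseq us xs"
  proof
    assume "ws = [x]"
    then have "last us = x" using vs(1) by simp
    then show ?thesis using \<open>last us \<noteq> x\<close> by blast
  qed (use vs in simp)
  then show "contains_pattern xs \<tau>" using iso by (auto simp: contains_pattern_iff_subseq)
qed (auto intro: contains_pattern_subseq)

text \<open>If \<open>x\<close> played the first letter of \<open>\<tau>\<close>, the letters at
  \<open>b\<close> and \<open>c\<close> would need two distinct values above \<open>x\<close>, but
  only \<open>y\<close> is available. Once \<open>x\<close> is excluded, \<open>y\<close> is a
  leading maximum.\<close>

lemma contains_pattern_Cons_Cons_max_drop:
  assumes "\<And>z. z \<in> set zs \<Longrightarrow> z < x" "x < y"
    and "b < length \<tau>" "\<tau> ! 0 < \<tau> ! b" "c < length \<tau>" "\<tau> ! b < \<tau> ! c"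
  shows "contains_pattern (x # y # zs) \<tau> \<longleftrightarrow> contains_pattern zs \<tau>"
proof -
  have "contains_pattern (y # zs) \<tau>" if contained: "contains_pattern (x # y # zs) \<tau>"
  proof -
    obtain us where us: "subseq us (x # y # zs)" and iso: "order_iso us \<tau>"
      using contained by (rule contains_patternE)
    have less: "us ! 0 < us ! b" "us ! b < us ! c" "b < length us" "c < length us"
      using order_iso_less_iff[OF iso _ assms(3), of 0] order_iso_less_iff[OF iso assms(3,5)]
        order_iso_length[OF iso] assms(3-6) by (cases \<tau>; simp)+
    have "us ! 0 \<noteq> x"
    proof
      assume "us ! 0 = x"
      moreover have "us ! b \<in> {x, y} \<union> set zs" "us ! c \<in> {x, y} \<union> set zs"
        using subseq_set[OF us] nth_mem[OF less(3)] nth_mem[OF less(4)] by auto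
      ultimately have "us ! b = y" "us ! c = y" using less(1,2) assms(1) by force+
      with less(2) show False by simp
    qed
    then have "subseq us (y # zs)" using us less(3) by (cases us) auto
    then show ?thesis using iso by (auto simp: contains_pattern_iff_subseq)
  qed
  moreover have "contains_pattern (y # zs) \<tau> \<longleftrightarrow> contains_pattern zs \<tau>"
    by (rule contains_pattern_Cons_max_drop[OF _ assms(3,4)]) (meson assms(1,2) less_trans)
  moreover have "contains_pattern (x # y # zs) \<tau>" if "contains_pattern zs \<tau>"
    using that by (rule contains_pattern_subseq) auto
  ultimately show ?thesis by blast
qed

lemma order_iso_Cons_max:
  assumes "\<And>t. t \<in> set \<tau> \<Longrightarrow> t < l"
  shows "order_iso (u # us) (l # \<tau>) \<longleftrightarrow> (\<forall>x\<in>set us. x < u) \<and> order_iso us \<tau>"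
proof -
  have "\<tau> ! a < l" if "a < length \<tau>" for a using assms that by simp
  moreover from this have "\<not> l < \<tau> ! a" if "a < length \<tau>" for a
    using that less_asym by blast
  ultimately show ?thesis
    unfolding order_iso_def
    by (auto simp: All_less_Suc2 all_set_conv_all_nth dest: less_asym)
qed

text \<open>Deleting the first letter of an occurrence leaves an occurrence of \<open>\<tau>\<close>
  inside \<open>xs\<close>, wherever that letter was; conversely \<open>x\<close> can play
  \<open>l\<close>.\<close>

lemma contains_pattern_Cons_max_Cons_max:
  assumes "\<And>y. y \<in> set xs \<Longrightarrow> y < x" "\<And>t. t \<in> set \<tau> \<Longrightarrow> t < l"
  shows "contains_pattern (x # xs) (l # \<tau>) \<longleftrightarrow> contains_pattern xs \<tau>"
proof
  assume "contains_pattern (x # xs) (l # \<tau>)"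
  then obtain us where "subseq us (x # xs)" and iso: "order_iso us (l # \<tau>)"
    by (auto simp: contains_pattern_iff_subseq)
  moreover obtain v vs where "us = v # vs" using iso by (cases us) (auto simp: order_iso_def)
  ultimately have "subseq vs xs" "order_iso vs \<tau>"
    using order_iso_Cons_max[OF assms(2)] by (auto dest: subseq_Cons' split: if_splits)
  then show "contains_pattern xs \<tau>" by (auto simp: contains_pattern_iff_subseq)
next
  assume "contains_pattern xs \<tau>"
  then obtain us where "subseq us xs" "order_iso us \<tau>"
    by (auto simp: contains_pattern_iff_subseq)
  then have "subseq (x # us) (x # xs)" "order_iso (x # us) (l # \<tau>)"
    using order_iso_Cons_max[OF assms(2)] assms(1) subseq_set[of us xs] by auto
  then show "contains_pattern (x # xs) (l # \<tau>)" by (auto simp: contains_pattern_iff_subseq)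
qed

text \<open>If an occurrence starts with \<open>x\<close>, all its other letters are below
  \<open>x\<close>, so it skips \<open>y\<close>. Otherwise it lies in \<open>y # zs\<close>, where
  \<open>y\<close> is a leading maximum.\<close>

lemma contains_pattern_Cons_Cons_max_Cons_max:
  assumes "\<And>z. z \<in> set zs \<Longrightarrow> z < x" "x < y" "\<And>t. t \<in> set \<tau> \<Longrightarrow> t < l"
  shows "contains_pattern (x # y # zs) (l # \<tau>) \<longleftrightarrow> contains_pattern zs \<tau>"
proof -
  have y: "contains_pattern (y # zs) (l # \<tau>) \<longleftrightarrow> contains_pattern zs \<tau>"
    using assms(3) by (intro contains_pattern_Cons_max_Cons_max) (meson assms(1,2) less_trans)
  have "contains_pattern zs \<tau>" if contained: "contains_pattern (x # y # zs) (l # \<tau>)"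
  proof -
    obtain us where us: "subseq us (x # y # zs)" and iso: "order_iso us (l # \<tau>)"
      using contained by (rule contains_patternE)
    obtain v vs where v: "us = v # vs" using iso by (cases us) (auto simp: order_iso_def)
    have vs: "\<forall>w\<in>set vs. w < v" "order_iso vs \<tau>"
      using iso v order_iso_Cons_max[OF assms(3)] by auto
    show ?thesis
    proof (cases "v = x")
      case True
      then have "y \<notin> set vs" using vs(1) assms(2) by auto
      moreover have "subseq vs (y # zs)" using us v True by simp
      ultimately have "subseq vs zs" by (cases vs) auto
      then show ?thesis using vs(2) by (auto simp: contains_pattern_iff_subseq)
    next
      case False
      then have "subseq us (y # zs)" using us v by simp
      then show ?thesis using iso y by (auto simp: contains_pattern_iff_subseq)
    qed
  qed
  moreover have "contains_pattern (x # y # zs) (l # \<tau>)" if "contains_pattern zs \<tau>"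
    using that[folded y] by (rule contains_pattern_subseq) auto
  ultimately show ?thesis by blast
qed

text \<open>The leading maximum together with the letter at \<open>i\<close> is a descending pair
  across every cut \<open>i\<close>.\<close>

lemma sum_indecomposable_Cons_max:
  assumes "\<And>t. t \<in> set \<tau> \<Longrightarrow> t < l"
  shows "sum_indecomposable (l # \<tau>)"
  unfolding sum_indecomposable_def
proof (intro allI impI)
  fix i assume "0 < i" "i < length (l # \<tau>)"
  then have "i - 1 < length \<tau>" by auto
  then have "(l # \<tau>) ! i < l"
    using assms \<open>0 < i\<close> by (simp add: nth_Cons')
  then have "0 < i" "i \<le> i" "i < length (l # \<tau>)" "\<not> (l # \<tau>) ! 0 < (l # \<tau>) ! i"
    using \<open>0 < i\<close> \<open>i < length (l # \<tau>)\<close> by auto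
  then show "\<exists>a b. a < i \<and> i \<le> b \<and> b < length (l # \<tau>) \<and> \<not> (l # \<tau>) ! a < (l # \<tau>) ! b"
    by blast
qed

lemma sum_indecomposable_2341: "sum_indecomposable [2,3,4,1]"
  unfolding sum_indecomposable_def
  \<comment> \<open>The first letter 2 and the last letter 1 are inverted across every cut.\<close>
  by (intro allI impI exI[of _ 0] exI[of _ 3]) auto

text \<open>No single pair serves all cuts: the letters 2 and 1 cross the first two, the letters 4
  and 3 the last.\<close>

lemma sum_indecomposable_2413: "sum_indecomposable [2,4,1,3]"
  unfolding sum_indecomposable_def
proof (intro allI impI)
  fix i :: nat assume "0 < i" "i < length [2,4,1,3::nat]"
  then consider "i \<le> 2" | "i = 3" by fastforce
  then show "\<exists>a b. a < i \<and> i \<le> b \<and> b < length [2,4,1,3::nat] \<and>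
      \<not> [2,4,1,3::nat] ! a < [2,4,1,3] ! b"
  proof cases
    case 1 with \<open>0 < i\<close> show ?thesis by (intro exI[of _ 0] exI[of _ 2]) auto
  next
    case 2 then show ?thesis by (intro exI[of _ 1] exI[of _ 3]) auto
  qed
qed

section \<open>Splitting a permutation into a low block and a high block\<close>

lemma set_interval_split:
  fixes A C :: "nat set"
  assumes "A \<union> C = {1..M}" "\<And>x y. x \<in> A \<Longrightarrow> y \<in> C \<Longrightarrow> x < y"
  shows "A = {1..card A}" "C = {card A + 1..M}"
proof -
  have A: "A = {1..card A}"
  proof (cases "A = {}")
    case False
    have fin: "finite A" using assms(1) by (metis finite_Un finite_atLeastAtMost)
    \<comment> \<open>\<open>A\<close> is closed downwards: a value of \<open>C\<close> would have
      to exceed \<open>Max A\<close>.\<close>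
    have "x \<in> A" if "1 \<le> x" "x \<le> Max A" for x
    proof -
      have "Max A \<in> A" using False fin by simp
      then have "Max A \<le> M" using assms(1) by auto
      then have "x \<in> A \<union> C" unfolding assms(1) using that by simp
      then show ?thesis using assms(2)[OF \<open>Max A \<in> A\<close>, of x] that by auto
    qed
    moreover have "A \<subseteq> {1..Max A}" using fin assms(1) by auto
    ultimately have "A = {1..Max A}" by auto
    then show ?thesis by (metis card_atLeastAtMost diff_Suc_1 One_nat_def)
  qed simp
  have "A \<inter> C = {}" using assms(2) by blast
  then have "C = {1..M} - A" using assms(1) by blast
  moreover have "{1..M} - {1..card A} = {card A + 1..M}" by auto
  ultimately show "C = {card A + 1..M}" using A by simp
  show "A = {1..card A}" by (rule A)
qed

text \<open>An even letter is followed by a smaller one, so it cannot be the minimum. This forces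
  the low block to have even length.\<close>

lemma dumont_word_Min_odd:
  assumes "dumont_word xs" "xs \<noteq> []"
  shows "odd (Min (set xs))"
proof
  assume "even (Min (set xs))"
  moreover have "Min (set xs) \<in> set xs" using assms(2) by simp
  then obtain ys zs where "xs = ys @ Min (set xs) # zs" by (meson split_list)
  moreover from this have "zs \<noteq> []" "hd zs < Min (set xs)"
    using dumont_word_even_descent assms(1) calculation by metis+
  ultimately show False
    by (metis Min_le UnCI finite_set hd_in_set leD list.set_intros(2) set_append)
qed

lemma dumont_word_suffix: "dumont_word (xs @ ys) \<Longrightarrow> dumont_word ys"
proof (induction xs)
  case (Cons x xs)
  then show ?case by (cases "xs @ ys") (auto split: if_splits)
qed simp

text \<open>The set of \<open>\<alpha>\<close> is \<open>{1..c}\<close>, and the least letter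
  \<open>c + 1\<close> of a nonempty \<open>as\<close> is odd, so \<open>c\<close> is even. The
  conclusion asserts only membership in \<open>perms\<close>; the Dumont property of the parts is
  recovered later from equivalences.\<close>

lemma dumont_word_split:
  assumes sets: "set \<alpha> \<union> set as = {1..2 * m}" and dist: "distinct (\<alpha> @ as)"
    and less: "\<And>x y. x \<in> set \<alpha> \<Longrightarrow> y \<in> set as \<Longrightarrow> x < y" and word: "dumont_word as"
  obtains j \<sigma> where "j \<le> m" "\<alpha> \<in> perms (2 * j)" "\<sigma> \<in> perms (2 * (m - j))" "as = map ((+) (2 * j)) \<sigma>"
proof -
  define c where "c = card (set \<alpha>)"
  have \<alpha>: "set \<alpha> = {1..c}" and as: "set as = {c + 1..2 * m}"
    using set_interval_split[OF sets less] by (auto simp: c_def)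
  have "c \<le> 2 * m"
    using card_mono[of "{1..2 * m}" "set \<alpha>"] sets by (auto simp: c_def)
  have "even c"
  proof (cases "as = []")
    \<comment> \<open>An empty upper block leaves no letter with a parity to inspect, but then
      \<open>c\<close> is the full length \<open>2 * m\<close>.\<close>
    case True
    then have "2 * m < c + 1" using as by (metis atLeastatMost_empty_iff linorder_not_le empty_set)
    then have "c = 2 * m" using \<open>c \<le> 2 * m\<close> by simp
    then show ?thesis by simp
  next
    case False
    then have "c + 1 \<le> 2 * m" using as by (metis atLeastatMost_empty set_empty linorder_not_le)
    then have "Min (set as) = c + 1" unfolding as by (intro Min_eqI) auto
    then show ?thesis using dumont_word_Min_odd[OF word False] by simp
  qed
  then obtain j where j: "c = 2 * j" by (elim evenE)
  define \<sigma> where "\<sigma> = map (\<lambda>x. x - c) as"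
  have map: "map ((+) c) \<sigma> = as"
    unfolding \<sigma>_def map_map by (rule map_idI) (auto simp: as)
  have "(+) c ` set \<sigma> = (+) c ` {1..2 * m - c}"
    using as \<open>c \<le> 2 * m\<close> by (simp flip: map)
  then have "set \<sigma> = {1..2 * m - c}"
    by (subst (asm) inj_image_eq_iff) auto
  moreover have "distinct \<sigma>" using dist unfolding map[symmetric] by (simp add: distinct_map)
  ultimately have "\<sigma> \<in> perms (2 * (m - j))" by (simp add: perms_iff j diff_mult_distrib2)
  moreover have "\<alpha> \<in> perms (2 * j)" using \<alpha> dist j by (simp add: perms_iff)
  ultimately show ?thesis using that[of j \<sigma>] map j \<open>c \<le> 2 * m\<close> by simp
qed

section \<open>The two shapes of a nonempty Dumont permutation avoiding 2341 and 2413\<close>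

definition wrap_last :: "nat list \<Rightarrow> nat list \<Rightarrow> nat list" where
  "wrap_last \<alpha> \<sigma> = \<alpha> @ (length \<alpha> + length \<sigma> + 2) #
     map ((+) (length \<alpha>)) \<sigma> @ [length \<alpha> + length \<sigma> + 1]"

definition wrap_first :: "nat list \<Rightarrow> nat list \<Rightarrow> nat list" where
  "wrap_first \<alpha> \<sigma> = \<alpha> @ (length \<alpha> + length \<sigma> + 1) #
     (length \<alpha> + length \<sigma> + 2) # map ((+) (length \<alpha>)) \<sigma>"

lemma order_iso_2413: "y < x \<Longrightarrow> x < z \<Longrightarrow> z < w \<Longrightarrow> order_iso [x, w, y, z] [2, 4, 1, 3]"
  by (auto simp: order_iso_def less_Suc_eq numeral_eq_Suc)

lemma order_iso_2341: "y < x \<Longrightarrow> x < z \<Longrightarrow> z < w \<Longrightarrow> order_iso [x, z, w, y] [2, 3, 4, 1]"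
  by (auto simp: order_iso_def less_Suc_eq numeral_eq_Suc)

lemma subseq_interleave:
  assumes "x \<in> set xs" "y \<in> set ys"
  shows "subseq (x # zs @ y # ws) (xs @ zs @ ys @ ws)"
proof -
  have "subseq [x] xs" "subseq [y] ys" using assms by (simp_all add: subseq_singleton_left)
  then have "subseq ([x] @ zs @ [y] @ ws) (xs @ zs @ ys @ ws)"
    by (intro list_emb_append_mono) auto
  then show ?thesis by simp
qed

text \<open>The position of the top odd letter \<open>2 * m + 1\<close> decides the shape: last, or
  directly before \<open>2 * m + 2\<close>. Each forbidden pattern rules out an inversion between
  the blocks in one of the two cases.\<close>

lemma dumont1_wrap_cases:
  assumes "\<pi> \<in> dumont1 (Suc m)" "avoids \<pi> [2,3,4,1]" "avoids \<pi> [2,4,1,3]"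
  obtains j \<alpha> \<sigma> where "j \<le> m" "\<alpha> \<in> perms (2 * j)" "\<sigma> \<in> perms (2 * (m - j))"
    "\<pi> = wrap_last \<alpha> \<sigma> \<or> j < m \<and> \<pi> = wrap_first \<alpha> \<sigma>"
proof -
  define N where "N = 2 * m + 2"
  have set: "set \<pi> = {1..N}" and dist: "distinct \<pi>" and word: "dumont_word \<pi>"
    using assms(1) by (auto simp: dumont1_iff perms_iff N_def)
  have "N - 1 \<in> set \<pi>" by (auto simp: set N_def)
  then obtain ps qs where \<pi>: "\<pi> = ps @ (N - 1) # qs" by (meson split_list)
  have odd: "odd (N - 1)" by (simp add: N_def)
  show ?thesis
  proof (cases "qs = []")
    case True
    have "N \<in> set \<pi>" "N \<noteq> N - 1" by (auto simp: set N_def)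
    then have "N \<in> set ps" using \<pi> True by auto
    then obtain \<alpha> as where ps: "ps = \<alpha> @ N # as" by (meson split_list)
    have \<pi>': "\<pi> = \<alpha> @ [N] @ as @ [N - 1]" using \<pi> True ps by simp
    have sets: "set \<alpha> \<union> set as = {1..2 * m}"
    proof -
      have "set \<alpha> \<union> set as = set \<pi> - {N - 1, N}" using dist by (auto simp: \<pi>')
      also have "\<dots> = {1..2 * m}" unfolding set by (auto simp: N_def)
      finally show ?thesis .
    qed
    have dist': "distinct (\<alpha> @ as)" using dist by (auto simp: \<pi>')
    \<comment> \<open>An inversion \<open>x\<close>, \<open>y\<close> around \<open>N\<close>,
      closed by the final \<open>N - 1\<close>, would form 2413.\<close>
    have less: "x < y" if x: "x \<in> set \<alpha>" and y: "y \<in> set as" for x y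
    proof (rule ccontr)
      assume "\<not> x < y"
      then have "y < x" using x y dist' by (auto simp: not_less_iff_gr_or_eq)
      moreover have "x \<in> {1..2 * m}" using x sets by blast
      then have "x < N - 1" "N - 1 < N" by (auto simp: N_def)
      ultimately have "order_iso [x, N, y, N - 1] [2, 4, 1, 3]" by (intro order_iso_2413)
      moreover have "subseq [x, N, y, N - 1] \<pi>"
        using subseq_interleave[OF x y, of "[N]" "[N - 1]"] by (simp add: \<pi>')
      ultimately show False using assms(3) by (auto simp: avoids_def contains_pattern_iff_subseq)
    qed
    have "dumont_word (as @ [N - 1])" using dumont_word_suffix[of "\<alpha> @ [N]"] word by (simp add: \<pi>')
    moreover have "y < N - 1" if "y \<in> set as" for y
    proof -
      have "y \<in> {1..2 * m}" using sets that by blast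
      then show ?thesis by (simp add: N_def)
    qed
    ultimately have "dumont_word as" by (subst (asm) dumont_word_append) auto
    from dumont_word_split[OF sets dist' less this] obtain j \<sigma> where
      j: "j \<le> m" "\<alpha> \<in> perms (2 * j)" "\<sigma> \<in> perms (2 * (m - j))" "as = map ((+) (2 * j)) \<sigma>" .
    moreover have "\<pi> = wrap_last \<alpha> \<sigma>"
      using j length_perms[OF j(2)] length_perms[OF j(3)] by (simp add: \<pi>' wrap_last_def N_def)
    ultimately show ?thesis using that by blast
  next
    case False
    \<comment> \<open>The odd letter \<open>N - 1\<close> is not last, so it is followed by an
      ascent, and \<open>N\<close> is the only larger letter.\<close>
    then have "N - 1 < hd qs" using dumont_word_odd_ascent word odd by (simp add: \<pi>)
    moreover have "hd qs \<in> set \<pi>" using False by (simp add: \<pi>)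
    ultimately have "hd qs = N" using set by auto
    then obtain as where qs: "qs = N # as" using False by (cases qs) auto
    have \<pi>': "\<pi> = ps @ [N - 1, N] @ as" using \<pi> qs by simp
    have sets: "set ps \<union> set as = {1..2 * m}"
    proof -
      have "set ps \<union> set as = set \<pi> - {N - 1, N}" using dist by (auto simp: \<pi>')
      also have "\<dots> = {1..2 * m}" unfolding set by (auto simp: N_def)
      finally show ?thesis .
    qed
    have dist': "distinct (ps @ as)" using dist by (auto simp: \<pi>')
    \<comment> \<open>Here an inversion around the adjacent letters \<open>N - 1\<close> and
      \<open>N\<close> would form 2341.\<close>
    have less: "x < y" if x: "x \<in> set ps" and y: "y \<in> set as" for x y
    proof (rule ccontr)
      assume "\<not> x < y"
      then have "y < x" using x y dist' by (auto simp: not_less_iff_gr_or_eq)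
      moreover have "x \<in> {1..2 * m}" using x sets by blast
      then have "x < N - 1" "N - 1 < N" by (auto simp: N_def)
      ultimately have "order_iso [x, N - 1, N, y] [2, 3, 4, 1]" by (intro order_iso_2341)
      moreover have "subseq [x, N - 1, N, y] \<pi>"
        using subseq_interleave[OF x y, of "[N - 1, N]" "[]"] by (simp add: \<pi>')
      ultimately show False using assms(2) by (auto simp: avoids_def contains_pattern_iff_subseq)
    qed
    have "dumont_word as" using dumont_word_suffix[of "ps @ [N - 1, N]"] word by (simp add: \<pi>')
    from dumont_word_split[OF sets dist' less this] obtain j \<sigma> where
      j: "j \<le> m" "ps \<in> perms (2 * j)" "\<sigma> \<in> perms (2 * (m - j))" "as = map ((+) (2 * j)) \<sigma>" .
    \<comment> \<open>The even letter \<open>N\<close> cannot end the word; this gives the strict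
      bound \<open>j < m\<close>.\<close>
    have "as \<noteq> []"
      using dumont_word_even_descent(1)[of "ps @ [N - 1]" N as] word by (simp add: \<pi>' N_def)
    then have "j \<noteq> m" using j(3,4) by (auto simp: perms_iff)
    moreover have "\<pi> = wrap_first ps \<sigma>"
      using j length_perms[OF j(2)] length_perms[OF j(3)] by (simp add: \<pi>' wrap_first_def N_def)
    ultimately show ?thesis using that j by (metis le_neq_implies_less)
  qed
qed

section \<open>Dumont property and pattern containment of the wrapped words\<close>

context
  fixes j k :: nat and \<alpha> \<sigma> :: "nat list"
  assumes \<alpha>: "\<alpha> \<in> perms (2 * j)" and \<sigma>: "\<sigma> \<in> perms (2 * k)"
begin

private definition N where "N = 2 * j + 2 * k + 2"
private definition "\<sigma>' = map ((+) (2 * j)) \<sigma>"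

private lemma wrap_eq: "wrap_last \<alpha> \<sigma> = \<alpha> @ N # \<sigma>' @ [N - 1]" "wrap_first \<alpha> \<sigma> = \<alpha> @ (N - 1) # N # \<sigma>'"
  by (simp_all add: wrap_last_def wrap_first_def length_perms[OF \<alpha>] length_perms[OF \<sigma>] N_def \<sigma>'_def)

private lemma sets: "set \<alpha> = {1..2 * j}" "set \<sigma>' = {2 * j + 1..2 * j + 2 * k}"
  using \<alpha> \<sigma> by (simp_all add: perms_iff \<sigma>'_def)

private lemma less: "x \<in> set \<alpha> \<Longrightarrow> y \<in> set (N # \<sigma>' @ [N - 1]) \<Longrightarrow> x < y"
  by (auto simp: sets N_def)

private lemma less': "x \<in> set \<alpha> \<Longrightarrow> y \<in> set ((N - 1) # N # \<sigma>') \<Longrightarrow> x < y"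
  by (auto simp: sets N_def)

private lemma less_top: "x \<in> set \<sigma>' \<Longrightarrow> x < N - 1" "x \<in> set (\<sigma>' @ [N - 1]) \<Longrightarrow> x < N" "N - 1 < N"
  by (auto simp: sets N_def)

lemma wrap_last_perms: "wrap_last \<alpha> \<sigma> \<in> perms (2 * Suc (j + k))"
proof -
  have "distinct \<alpha>" "distinct \<sigma>'" using \<alpha> \<sigma> by (simp_all add: perms_iff \<sigma>'_def distinct_map)
  then show ?thesis unfolding perms_iff wrap_eq by (auto simp: sets N_def)
qed

lemma wrap_first_perms: "wrap_first \<alpha> \<sigma> \<in> perms (2 * Suc (j + k))"
proof -
  have "distinct \<alpha>" "distinct \<sigma>'" using \<alpha> \<sigma> by (simp_all add: perms_iff \<sigma>'_def distinct_map)
  then show ?thesis unfolding perms_iff wrap_eq by (auto simp: sets N_def)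
qed

lemma dumont_word_wrap_last: "dumont_word (wrap_last \<alpha> \<sigma>) \<longleftrightarrow> dumont_word \<alpha> \<and> dumont_word \<sigma>"
proof -
  have "dumont_word (wrap_last \<alpha> \<sigma>) \<longleftrightarrow> dumont_word \<alpha> \<and> dumont_word (N # \<sigma>' @ [N - 1])"
    unfolding wrap_eq using less by (intro dumont_word_append)
  also have "dumont_word (N # \<sigma>' @ [N - 1]) \<longleftrightarrow> dumont_word (\<sigma>' @ [N - 1])"
    using less_top(2) by (intro dumont_word_Cons_even) (auto simp: N_def)
  also have "\<dots> \<longleftrightarrow> dumont_word \<sigma>' \<and> dumont_word [N - 1]"
    using less_top(1) by (intro dumont_word_append) auto
  also have "\<dots> \<longleftrightarrow> dumont_word \<sigma>"
    by (simp add: \<sigma>'_def dumont_word_map_add_even N_def)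
  finally show ?thesis .
qed

text \<open>With \<open>k = 0\<close> the word would end in the even letter \<open>N\<close>,
  whatever \<open>\<alpha>\<close> is; hence the assumption \<open>k > 0\<close>.\<close>

lemma dumont_word_wrap_first:
  assumes "k > 0"
  shows "dumont_word (wrap_first \<alpha> \<sigma>) \<longleftrightarrow> dumont_word \<alpha> \<and> dumont_word \<sigma>"
proof -
  have "\<sigma>' \<noteq> []" using assms length_perms[OF \<sigma>] by (auto simp: \<sigma>'_def)
  have "dumont_word (wrap_first \<alpha> \<sigma>) \<longleftrightarrow> dumont_word \<alpha> \<and> dumont_word ((N - 1) # N # \<sigma>')"
    unfolding wrap_eq using less' by (intro dumont_word_append)
  also have "dumont_word ((N - 1) # N # \<sigma>') \<longleftrightarrow> dumont_word (N # \<sigma>')"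
    by (simp add: N_def)
  also have "\<dots> \<longleftrightarrow> dumont_word \<sigma>'"
    using less_top(2) \<open>\<sigma>' \<noteq> []\<close> by (intro dumont_word_Cons_even) (auto simp: N_def)
  also have "\<dots> \<longleftrightarrow> dumont_word \<sigma>"
    by (simp add: \<sigma>'_def dumont_word_map_add_even)
  finally show ?thesis .
qed

text \<open>For patterns that neither begin nor end with their maximum: \<open>b\<close> prevents
  the leading \<open>N\<close> from being used, and \<open>c\<close> the final
  \<open>N - 1\<close>.\<close>

lemma contains_wrap_last:
  assumes "sum_indecomposable \<tau>" "b < length \<tau>" "\<tau> ! 0 < \<tau> ! b" "c < length \<tau>" "last \<tau> < \<tau> ! c"
  shows "contains_pattern (wrap_last \<alpha> \<sigma>) \<tau> \<longleftrightarrow> contains_pattern \<alpha> \<tau> \<or> contains_pattern \<sigma> \<tau>"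
proof -
  have "contains_pattern (wrap_last \<alpha> \<sigma>) \<tau> \<longleftrightarrow>
      contains_pattern \<alpha> \<tau> \<or> contains_pattern (N # \<sigma>' @ [N - 1]) \<tau>"
    unfolding wrap_eq using less assms(1) by (rule contains_pattern_append)
  also have "contains_pattern (N # \<sigma>' @ [N - 1]) \<tau> \<longleftrightarrow> contains_pattern (\<sigma>' @ [N - 1]) \<tau>"
    using less_top(2) assms(2,3) by (rule contains_pattern_Cons_max_drop)
  also have "\<dots> \<longleftrightarrow> contains_pattern \<sigma>' \<tau>"
    using less_top(1) assms(4,5) by (rule contains_pattern_snoc_max_drop)
  finally show ?thesis by (simp add: \<sigma>'_def contains_pattern_map_add)
qed

lemma contains_wrap_first:
  assumes "sum_indecomposable \<tau>" "b < length \<tau>" "\<tau> ! 0 < \<tau> ! b" "c < length \<tau>" "\<tau> ! b < \<tau> ! c"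
  shows "contains_pattern (wrap_first \<alpha> \<sigma>) \<tau> \<longleftrightarrow> contains_pattern \<alpha> \<tau> \<or> contains_pattern \<sigma> \<tau>"
proof -
  have "contains_pattern (wrap_first \<alpha> \<sigma>) \<tau> \<longleftrightarrow>
      contains_pattern \<alpha> \<tau> \<or> contains_pattern ((N - 1) # N # \<sigma>') \<tau>"
    unfolding wrap_eq using less' assms(1) by (rule contains_pattern_append)
  also have "contains_pattern ((N - 1) # N # \<sigma>') \<tau> \<longleftrightarrow> contains_pattern \<sigma>' \<tau>"
    using less_top(1,3) assms(2-5) by (rule contains_pattern_Cons_Cons_max_drop)
  finally show ?thesis by (simp add: \<sigma>'_def contains_pattern_map_add)
qed

text \<open>The letter \<open>N\<close> plays \<open>l\<close>, which reduces the pattern to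
  \<open>\<tau>\<close>; the final \<open>N - 1\<close> cannot contribute because
  \<open>\<tau>\<close> does not end in its maximum.\<close>

lemma contains_wrap_last_Cons_max:
  assumes "\<And>t. t \<in> set \<tau> \<Longrightarrow> t < l" "b < length \<tau>" "last \<tau> < \<tau> ! b"
  shows "contains_pattern (wrap_last \<alpha> \<sigma>) (l # \<tau>) \<longleftrightarrow>
    contains_pattern \<alpha> (l # \<tau>) \<or> contains_pattern \<sigma> \<tau>"
proof -
  have "contains_pattern (wrap_last \<alpha> \<sigma>) (l # \<tau>) \<longleftrightarrow>
      contains_pattern \<alpha> (l # \<tau>) \<or> contains_pattern (N # \<sigma>' @ [N - 1]) (l # \<tau>)"
    unfolding wrap_eq using less sum_indecomposable_Cons_max[OF assms(1)]
    by (rule contains_pattern_append)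
  also have "contains_pattern (N # \<sigma>' @ [N - 1]) (l # \<tau>) \<longleftrightarrow> contains_pattern (\<sigma>' @ [N - 1]) \<tau>"
    using less_top(2) assms(1) by (rule contains_pattern_Cons_max_Cons_max)
  also have "\<dots> \<longleftrightarrow> contains_pattern \<sigma>' \<tau>"
    using less_top(1) assms(2,3) by (rule contains_pattern_snoc_max_drop)
  finally show ?thesis by (simp add: \<sigma>'_def contains_pattern_map_add)
qed

lemma contains_wrap_first_Cons_max:
  assumes "\<And>t. t \<in> set \<tau> \<Longrightarrow> t < l"
  shows "contains_pattern (wrap_first \<alpha> \<sigma>) (l # \<tau>) \<longleftrightarrow>
    contains_pattern \<alpha> (l # \<tau>) \<or> contains_pattern \<sigma> \<tau>"
proof -
  have "contains_pattern (wrap_first \<alpha> \<sigma>) (l # \<tau>) \<longleftrightarrow>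
      contains_pattern \<alpha> (l # \<tau>) \<or> contains_pattern ((N - 1) # N # \<sigma>') (l # \<tau>)"
    unfolding wrap_eq using less' sum_indecomposable_Cons_max[OF assms]
    by (rule contains_pattern_append)
  also have "contains_pattern ((N - 1) # N # \<sigma>') (l # \<tau>) \<longleftrightarrow> contains_pattern \<sigma>' \<tau>"
    using less_top(1,3) assms by (rule contains_pattern_Cons_Cons_max_Cons_max)
  finally show ?thesis by (simp add: \<sigma>'_def contains_pattern_map_add)
qed

end

section \<open>Wrapping as a bijection onto the avoiding permutations\<close>

definition D :: "nat \<Rightarrow> nat list \<Rightarrow> nat list set" where
  "D n \<tau> = dumont1_avoiding n {[2,3,4,1], [2,4,1,3], \<tau>}"

lemma D_iff:
  "\<pi> \<in> D n \<tau> \<longleftrightarrow> \<pi> \<in> perms (2 * n) \<and> dumont_word \<pi> \<and> \<not> contains_pattern \<pi> [2,3,4,1] \<and>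
     \<not> contains_pattern \<pi> [2,4,1,3] \<and> \<not> contains_pattern \<pi> \<tau>"
  by (auto simp: D_def dumont1_avoiding_def dumont1_iff avoids_def)

lemma D_perms: "\<pi> \<in> D n \<tau> \<Longrightarrow> \<pi> \<in> perms (2 * n)"
  by (simp add: D_iff)

lemma finite_D: "finite (D n \<tau>)"
  using finite_subset[OF _ finite_perms] D_perms by blast

text \<open>The patterns 2341 and 2413 are inherited unchanged by both blocks; only the third
  pattern loses its leading maximum on the \<open>\<sigma>\<close> side.\<close>

lemma wrap_last_in_D_iff:
  assumes "\<alpha> \<in> perms (2 * j)" "\<sigma> \<in> perms (2 * k)"
    and "\<And>t. t \<in> set \<tau> \<Longrightarrow> t < l" "b < length \<tau>" "last \<tau> < \<tau> ! b"
  shows "wrap_last \<alpha> \<sigma> \<in> D (Suc (j + k)) (l # \<tau>) \<longleftrightarrow> \<alpha> \<in> D j (l # \<tau>) \<and> \<sigma> \<in> D k \<tau>"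
proof -
  have max: "contains_pattern (wrap_last \<alpha> \<sigma>) (l # \<tau>) \<longleftrightarrow>
      contains_pattern \<alpha> (l # \<tau>) \<or> contains_pattern \<sigma> \<tau>"
    using assms by (rule contains_wrap_last_Cons_max)
  \<comment> \<open>In both patterns position 1 holds a letter (3 and 4, respectively) above the
    first and the last letter.\<close>
  have wrap: "contains_pattern (wrap_last \<alpha> \<sigma>) p \<longleftrightarrow> contains_pattern \<alpha> p \<or> contains_pattern \<sigma> p"
    if "p \<in> {[2,3,4,1], [2,4,1,3]}" for p
    using that sum_indecomposable_2341 sum_indecomposable_2413
      contains_wrap_last[OF assms(1,2), of p 1 1] contains_wrap_last[OF assms(1,2), of p 1 2] by auto
  show ?thesis
    using wrap_last_perms[OF assms(1,2)] assms(1,2) wrap[of "[2,3,4,1]"] wrap[of "[2,4,1,3]"]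
    unfolding D_iff dumont_word_wrap_last[OF assms(1,2)] max by blast
qed

lemma wrap_first_in_D_iff:
  assumes "\<alpha> \<in> perms (2 * j)" "\<sigma> \<in> perms (2 * k)" "\<And>t. t \<in> set \<tau> \<Longrightarrow> t < l" "k > 0"
  shows "wrap_first \<alpha> \<sigma> \<in> D (Suc (j + k)) (l # \<tau>) \<longleftrightarrow> \<alpha> \<in> D j (l # \<tau>) \<and> \<sigma> \<in> D k \<tau>"
proof -
  have max: "contains_pattern (wrap_first \<alpha> \<sigma>) (l # \<tau>) \<longleftrightarrow>
      contains_pattern \<alpha> (l # \<tau>) \<or> contains_pattern \<sigma> \<tau>"
    using assms(1-3) by (rule contains_wrap_first_Cons_max)
  \<comment> \<open>Both patterns start with 2; the two larger letters 3 and 4 stand at positions 1,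
    2 in 2341 and at 3, 1 in 2413.\<close>
  have wrap: "contains_pattern (wrap_first \<alpha> \<sigma>) p \<longleftrightarrow> contains_pattern \<alpha> p \<or> contains_pattern \<sigma> p"
    if "p \<in> {[2,3,4,1], [2,4,1,3]}" for p
    using that sum_indecomposable_2341 sum_indecomposable_2413
      contains_wrap_first[OF assms(1,2), of p 1 2] contains_wrap_first[OF assms(1,2), of p 3 1] by auto
  show ?thesis
    using wrap_first_perms[OF assms(1,2)] assms(1,2) wrap[of "[2,3,4,1]"] wrap[of "[2,4,1,3]"]
    unfolding D_iff dumont_word_wrap_first[OF assms(1,2,4)] max by blast
qed

text \<open>The unique letter \<open>2 * m + 2\<close> marks where \<open>\<alpha>\<close> ends; the
  length of \<open>\<alpha>\<close> gives \<open>j\<close>, and undoing the shift gives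
  \<open>\<sigma>\<close>.\<close>

lemma wrap_last_inject:
  assumes "\<alpha> \<in> perms (2 * j)" "\<sigma> \<in> perms (2 * (m - j))" "j \<le> m"
    and "\<beta> \<in> perms (2 * i)" "\<rho> \<in> perms (2 * (m - i))" "i \<le> m"
    and "wrap_last \<alpha> \<sigma> = wrap_last \<beta> \<rho>"
  shows "j = i \<and> \<alpha> = \<beta> \<and> \<sigma> = \<rho>"
proof -
  note len = assms(1,2,4,5)[THEN length_perms]
  have add: "2 * j + 2 * (m - j) = 2 * m" "2 * i + 2 * (m - i) = 2 * m"
    using assms(3,6) by simp_all
  have "\<alpha> @ (2 * m + 2) # map ((+) (2 * j)) \<sigma> @ [2 * m + 1] =
        \<beta> @ (2 * m + 2) # map ((+) (2 * i)) \<rho> @ [2 * m + 1]"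
    using assms(7) by (simp add: wrap_last_def len add)
  moreover have "2 * m + 2 \<notin> set \<alpha> \<union> set \<beta>" using assms by (auto simp: perms_iff)
  moreover have "2 * m + 2 \<notin> set (map ((+) (2 * j)) \<sigma> @ [2 * m + 1])"
    using assms(2,3) by (auto simp: perms_iff)
  ultimately have "\<alpha> = \<beta>" "map ((+) (2 * j)) \<sigma> = map ((+) (2 * i)) \<rho>"
    by (auto simp: append_Cons_eq_iff)
  moreover from this have "j = i" using len by simp
  ultimately show ?thesis by (simp add: inj_map_eq_map)
qed

lemma wrap_first_inject:
  assumes "\<alpha> \<in> perms (2 * j)" "\<sigma> \<in> perms (2 * (m - j))" "j \<le> m"
    and "\<beta> \<in> perms (2 * i)" "\<rho> \<in> perms (2 * (m - i))" "i \<le> m"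
    and "wrap_first \<alpha> \<sigma> = wrap_first \<beta> \<rho>"
  shows "j = i \<and> \<alpha> = \<beta> \<and> \<sigma> = \<rho>"
proof -
  note len = assms(1,2,4,5)[THEN length_perms]
  have add: "2 * j + 2 * (m - j) = 2 * m" "2 * i + 2 * (m - i) = 2 * m"
    using assms(3,6) by simp_all
  have "\<alpha> @ (2 * m + 1) # (2 * m + 2) # map ((+) (2 * j)) \<sigma> =
        \<beta> @ (2 * m + 1) # (2 * m + 2) # map ((+) (2 * i)) \<rho>"
    using assms(7) by (simp add: wrap_first_def len add)
  moreover have "2 * m + 1 \<notin> set \<alpha> \<union> set \<beta>" using assms by (auto simp: perms_iff)
  moreover have "2 * m + 1 \<notin> set ((2 * m + 2) # map ((+) (2 * j)) \<sigma>)"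
    using assms(2,3) by (auto simp: perms_iff)
  ultimately have "\<alpha> = \<beta>" "map ((+) (2 * j)) \<sigma> = map ((+) (2 * i)) \<rho>"
    by (auto simp: append_Cons_eq_iff)
  moreover from this have "j = i" using len by simp
  ultimately show ?thesis by (simp add: inj_map_eq_map)
qed

text \<open>The last letters differ: \<open>2 * m + 1\<close> on one side and, since
  \<open>i < m\<close> makes \<open>\<rho>\<close> nonempty, at most \<open>2 * m\<close> on the
  other.\<close>

lemma wrap_last_neq_wrap_first:
  assumes "\<alpha> \<in> perms (2 * j)" "\<sigma> \<in> perms (2 * (m - j))" "j \<le> m"
    and "\<beta> \<in> perms (2 * i)" "\<rho> \<in> perms (2 * (m - i))" "i < m"
  shows "wrap_last \<alpha> \<sigma> \<noteq> wrap_first \<beta> \<rho>"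
proof
  assume "wrap_last \<alpha> \<sigma> = wrap_first \<beta> \<rho>"
  then have "last (wrap_last \<alpha> \<sigma>) = last (wrap_first \<beta> \<rho>)" by simp
  moreover have "last (wrap_last \<alpha> \<sigma>) = 2 * m + 1"
    using assms(3)
    by (simp add: wrap_last_def length_perms[OF assms(1)] length_perms[OF assms(2)])
  moreover have "\<rho> \<noteq> []" using length_perms[OF assms(5)] assms(6) by auto
  then have "last (wrap_first \<beta> \<rho>) = 2 * i + last \<rho>" "last \<rho> \<in> set \<rho>"
    by (simp_all add: wrap_first_def length_perms[OF assms(4)] last_map)
  moreover have "last \<rho> \<le> 2 * (m - i)" using calculation(4) assms(5) by (auto simp: perms_iff)
  ultimately show False using assms(6) by simp
qed

section \<open>The recurrence and the generating function\<close>

lemma B_nth: "fps_nth (B \<tau>) n = of_nat (card (D n \<tau>))"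
  by (simp add: B_def D_def)

text \<open>The first sum counts the words \<open>wrap_last\<close>, the second the words
  \<open>wrap_first\<close>; the second omits \<open>j = m\<close>, where \<open>\<sigma>\<close>
  would be empty.\<close>

lemma card_D_Suc:
  assumes "\<And>t. t \<in> set \<tau> \<Longrightarrow> t < l" "b < length \<tau>" "last \<tau> < \<tau> ! b"
  shows "card (D (Suc m) (l # \<tau>)) =
    (\<Sum>j\<le>m. card (D j (l # \<tau>)) * card (D (m - j) \<tau>)) +
    (\<Sum>j<m. card (D j (l # \<tau>)) * card (D (m - j) \<tau>))"
proof -
  let ?S = "\<lambda>J. SIGMA j:J. D j (l # \<tau>) \<times> D (m - j) \<tau>"
  let ?f = "\<lambda>(j, \<alpha>, \<sigma>). wrap_last \<alpha> \<sigma>" and ?g = "\<lambda>(j, \<alpha>, \<sigma>). wrap_first \<alpha> \<sigma>"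
  have card_S: "card (?S J) = (\<Sum>j\<in>J. card (D j (l # \<tau>)) * card (D (m - j) \<tau>))" if "finite J" for J
    using that by (subst card_SigmaI) (simp_all add: finite_D card_cartesian_product)
  have last: "wrap_last \<alpha> \<sigma> \<in> D (Suc m) (l # \<tau>) \<longleftrightarrow> \<alpha> \<in> D j (l # \<tau>) \<and> \<sigma> \<in> D (m - j) \<tau>"
    if "j \<le> m" "\<alpha> \<in> perms (2 * j)" "\<sigma> \<in> perms (2 * (m - j))" for j \<alpha> \<sigma>
    using wrap_last_in_D_iff[OF that(2,3) assms] that(1) by simp
  have first: "wrap_first \<alpha> \<sigma> \<in> D (Suc m) (l # \<tau>) \<longleftrightarrow> \<alpha> \<in> D j (l # \<tau>) \<and> \<sigma> \<in> D (m - j) \<tau>"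
    if "j < m" "\<alpha> \<in> perms (2 * j)" "\<sigma> \<in> perms (2 * (m - j))" for j \<alpha> \<sigma>
    using wrap_first_in_D_iff[OF that(2,3) assms(1)] that(1) by simp
  have "D (Suc m) (l # \<tau>) = ?f ` ?S {..m} \<union> ?g ` ?S {..<m}" (is "_ = ?R")
  proof (intro equalityI subsetI)
    fix \<pi> assume \<pi>: "\<pi> \<in> D (Suc m) (l # \<tau>)"
    then have "\<pi> \<in> dumont1 (Suc m)" "avoids \<pi> [2,3,4,1]" "avoids \<pi> [2,4,1,3]"
      by (auto simp: D_def dumont1_avoiding_def)
    then obtain j \<alpha> \<sigma> where j: "j \<le> m" "\<alpha> \<in> perms (2 * j)" "\<sigma> \<in> perms (2 * (m - j))"
      and "\<pi> = wrap_last \<alpha> \<sigma> \<or> j < m \<and> \<pi> = wrap_first \<alpha> \<sigma>"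
      by (rule dumont1_wrap_cases)
    then consider "\<pi> = wrap_last \<alpha> \<sigma>" | "j < m" "\<pi> = wrap_first \<alpha> \<sigma>" by blast
    then show "\<pi> \<in> ?R"
    proof cases
      case 1
      then have "(j, \<alpha>, \<sigma>) \<in> ?S {..m}" using last[OF j] \<pi> j(1) by simp
      then have "?f (j, \<alpha>, \<sigma>) \<in> ?f ` ?S {..m}" by (rule imageI)
      then show ?thesis using 1 by simp
    next
      case 2
      then have "(j, \<alpha>, \<sigma>) \<in> ?S {..<m}" using first[OF 2(1) j(2,3)] \<pi> by simp
      then have "?g (j, \<alpha>, \<sigma>) \<in> ?g ` ?S {..<m}" by (rule imageI)
      then show ?thesis using 2 by simp
    qed
  next
    fix \<pi> assume "\<pi> \<in> ?R"
    then consider j \<alpha> \<sigma> where "j \<le> m" "\<alpha> \<in> D j (l # \<tau>)" "\<sigma> \<in> D (m - j) \<tau>" "\<pi> = wrap_last \<alpha> \<sigma>"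
      | j \<alpha> \<sigma> where "j < m" "\<alpha> \<in> D j (l # \<tau>)" "\<sigma> \<in> D (m - j) \<tau>" "\<pi> = wrap_first \<alpha> \<sigma>"
      by fastforce
    then show "\<pi> \<in> D (Suc m) (l # \<tau>)"
      by cases (use last first D_perms in blast)+
  qed
  moreover have "?f ` ?S {..m} \<inter> ?g ` ?S {..<m} = {}"
    using wrap_last_neq_wrap_first[OF D_perms D_perms _ D_perms D_perms] by auto
  moreover have "inj_on ?f (?S {..m})"
    by (intro inj_onI) (auto dest: wrap_last_inject[OF D_perms D_perms _ D_perms D_perms])
  moreover have "inj_on ?g (?S {..<m})"
    by (intro inj_onI) (auto dest: wrap_first_inject[OF D_perms D_perms _ D_perms D_perms])
  ultimately show ?thesis
    by (simp add: card_Un_disjoint card_image card_S finite_D)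
qed

text \<open>The empty pattern must be excluded, since every word, even the empty one, contains
  it.\<close>

lemma card_D_0: "\<tau> \<noteq> [] \<Longrightarrow> card (D 0 \<tau>) = 1"
proof -
  assume "\<tau> \<noteq> []"
  moreover have "\<not> contains_pattern [] p" if "p \<noteq> []" for p
    using that unfolding contains_pattern_def by (metis length_greater_0_conv less_nat_zero_code list.size(3))
  ultimately have "D 0 \<tau> = {[]}" by (auto simp: D_iff perms_iff)
  then show ?thesis by simp
qed

lemma B_rec:
  assumes "\<And>t. t \<in> set \<tau> \<Longrightarrow> t < l" "b < length \<tau>" "last \<tau> < \<tau> ! b"
  shows "B (l # \<tau>) = 1 + fps_X * (B (l # \<tau>) * (2 * B \<tau> - 1))"
proof (rule fps_ext)
  fix n
  have "\<tau> \<noteq> []" using assms(2) by auto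
  show "fps_nth (B (l # \<tau>)) n = fps_nth (1 + fps_X * (B (l # \<tau>) * (2 * B \<tau> - 1))) n"
  proof (cases n)
    case 0
    then show ?thesis by (simp add: B_nth card_D_0)
  next
    case (Suc m)
    let ?b = "\<lambda>j. rat_of_nat (card (D j (l # \<tau>)))" and ?c = "\<lambda>j. rat_of_nat (card (D j \<tau>))"
    have "fps_nth (B (l # \<tau>)) n = (\<Sum>j\<le>m. ?b j * ?c (m - j)) + (\<Sum>j<m. ?b j * ?c (m - j))"
      unfolding B_nth Suc by (subst card_D_Suc[OF _ assms(2,3)]) (simp_all add: assms(1))
    \<comment> \<open>Completing the second sum adds the term \<open>j = m\<close>, which is
      \<open>?b m\<close> because \<open>?c 0 = 1\<close>.\<close>
    also have "\<dots> = 2 * (\<Sum>j\<le>m. ?b j * ?c (m - j)) - ?b m"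
      using card_D_0[OF \<open>\<tau> \<noteq> []\<close>] by (simp flip: lessThan_Suc_atMost)
    also have "\<dots> = fps_nth (2 * (B (l # \<tau>) * B \<tau>) - B (l # \<tau>)) m"
      unfolding mult_2 fps_sub_nth fps_add_nth fps_mult_nth B_nth atMost_atLeast0 by (rule refl)
    also have "\<dots> = fps_nth (1 + fps_X * (B (l # \<tau>) * (2 * B \<tau> - 1))) n"
      by (simp add: Suc algebra_simps)
    finally show ?thesis .
  qed
qed

theorem theorem4p4:
  fixes l :: nat and \<tau> \<tau>' :: "nat list"
  assumes "l \<ge> 2"
    and "\<tau> \<in> perms l"
    and "\<tau>' \<in> perms (l - 1)"
    and "\<tau> = l # \<tau>'"
    and "last \<tau> \<noteq> l - 1"
  shows "B \<tau> = 1 / (1 + fps_X - 2 * fps_X * B \<tau>')"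
proof -
  have "\<tau>' \<noteq> []" using length_perms[OF assms(3)] assms(1) by auto
  have set: "set \<tau>' = {1..l - 1}" using assms(3) by (simp add: perms_iff)
  then have less: "t < l" if "t \<in> set \<tau>'" for t using that by auto
  have "l - 1 \<in> set \<tau>'" using set assms(1) by simp
  \<comment> \<open>The position of the maximum of \<open>\<tau>'\<close>; by the assumption on
    \<open>last \<tau>\<close> it is not the last one.\<close>
  then obtain b where b: "b < length \<tau>'" "\<tau>' ! b = l - 1" by (auto simp: in_set_conv_nth)
  have "last \<tau>' \<in> set \<tau>'" using \<open>\<tau>' \<noteq> []\<close> by simp
  then have "last \<tau>' < \<tau>' ! b" using assms(4,5) \<open>\<tau>' \<noteq> []\<close> set b(2) by auto
  let ?d = "1 + fps_X - 2 * fps_X * B \<tau>'"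
  have "B \<tau> = 1 + fps_X * (B \<tau> * (2 * B \<tau>' - 1))"
    unfolding assms(4) using less b(1) \<open>last \<tau>' < \<tau>' ! b\<close> by (rule B_rec)
  then have "?d * B \<tau> = 1" by (simp add: algebra_simps)
  then have "inverse ?d = B \<tau>" by (rule fps_inverse_unique)
  \<comment> \<open>The constant term of \<open>?d\<close> is 1, so \<open>?d\<close> is a unit and
    the division is multiplication by its inverse.\<close>
  moreover have "fps_nth ?d 0 \<noteq> 0" by simp
  ultimately show ?thesis by (simp add: fps_divide_unit)
qed

end
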